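(* Let $G$ be a torsion abelian group and let $\varphi\in\mathrm{End}(G)$ be surjective. The following conditions are equivalent: (i) $ns(\varphi)=0$; (ii) $ns(\varphi)<\infty$; (iii) $\mathrm{ent}(\varphi)=0$.
   Context: $\mathbb N=\{0,1,2,\dots\}$ and $\mathbb N_+=\mathbb N\setminus\{0\}$. For an endomorphism $\varphi$ of an abelian group $G$: $Q\mathrm{Per}(\varphi)$ is the set of $x\in G$ such that $\varphi^n(x)=\varphi^m(x)$ for some $n<m$ in $\mathbb N$. A string of $\varphi$ is a sequence $S=\{x_n\}_{n\in\mathbb N}$ of pairwise distinct elements of $G$ with $\varphi(x_n)=x_{n-1}$ for every $n\in\mathbb N_+$. A string is singular if $x_0\in Q\mathrm{Per}(\varphi)$, and non-singular otherwise. The non-singular string number is $ns(\varphi)=\sup\{|\mathcal F|:\mathcal F$ is a family of pairwise disjoint non-singular strings of $\varphi$ in $G\}$ (disjointness refers to the underlying sets of elements); it takes values in $\mathbb N\cup\{\infty\}$, i.e. it is set equal to $\infty$ whenever the supremum is infinite. Algebraic entropy: for a finite subgroup $F$ of $G$ and $n\in\mathbb N_+$ let $T_n(\varphi,F)=F+\varphi(F)+\dots+\varphi^{n-1}(F)$, $H(\varphi,F)=\lim_{n\to\infty}\frac{\log|T_n(\varphi,F)|}{n}$ (the limit exists), and $\mathrm{ent}(\varphi)=\sup\{H(\varphi,F):F$ is a finite subgroup of $G\}$. *)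

theory Defs
  imports Complex_Main "HOL-Library.Extended_Nat" "HOL-Library.Extended_Real"
    "HOL-Library.Disjoint_Sets" "HOL-Algebra.Algebra"
begin

text \<open>
  Groups are written multiplicatively, following HOL-Algebra: the sum of subgroups is the set
  product \<open><#>\<close>.
\<close>

definition torsion_group :: "('a, 'b) monoid_scheme \<Rightarrow> bool" where
  "torsion_group G \<longleftrightarrow> group G \<and> (\<forall>x\<in>carrier G. \<exists>n::nat. n > 0 \<and> x [^]\<^bsub>G\<^esub> n = \<one>\<^bsub>G\<^esub>)"

definition QPer :: "('a, 'b) monoid_scheme \<Rightarrow> ('a \<Rightarrow> 'a) \<Rightarrow> 'a set" where
  "QPer G \<phi> = {x \<in> carrier G. \<exists>n m. n < m \<and> (\<phi> ^^ n) x = (\<phi> ^^ m) x}"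

definition is_string :: "('a, 'b) monoid_scheme \<Rightarrow> ('a \<Rightarrow> 'a) \<Rightarrow> (nat \<Rightarrow> 'a) \<Rightarrow> bool" where
  "is_string G \<phi> x \<longleftrightarrow> range x \<subseteq> carrier G \<and> inj x \<and> (\<forall>n\<ge>1. \<phi> (x n) = x (n - 1))"

definition singular :: "('a, 'b) monoid_scheme \<Rightarrow> ('a \<Rightarrow> 'a) \<Rightarrow> (nat \<Rightarrow> 'a) \<Rightarrow> bool" where
  "singular G \<phi> x \<longleftrightarrow> x 0 \<in> QPer G \<phi>"

definition nonsingular_string_family ::
    "('a, 'b) monoid_scheme \<Rightarrow> ('a \<Rightarrow> 'a) \<Rightarrow> (nat \<Rightarrow> 'a) set \<Rightarrow> bool" where
  "nonsingular_string_family G \<phi> \<F> \<longleftrightarrow>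
     (\<forall>x\<in>\<F>. is_string G \<phi> x \<and> \<not> singular G \<phi> x) \<and> disjoint_family_on range \<F>"

definition ecardinality :: "'a set \<Rightarrow> enat" where
  "ecardinality A = (if finite A then enat (card A) else \<infinity>)"

definition ns :: "('a, 'b) monoid_scheme \<Rightarrow> ('a \<Rightarrow> 'a) \<Rightarrow> enat" where
  "ns G \<phi> = (SUP \<F> \<in> {\<F>. nonsingular_string_family G \<phi> \<F>}. ecardinality \<F>)"

text \<open>\<open>trajectory G \<phi> F n\<close> is \<open>T\<^sub>n(\<phi>, F)\<close>; the value at \<open>0\<close> is the empty sum.\<close>

primrec trajectory ::
    "('a, 'b) monoid_scheme \<Rightarrow> ('a \<Rightarrow> 'a) \<Rightarrow> 'a set \<Rightarrow> nat \<Rightarrow> 'a set" where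
  "trajectory G \<phi> F 0 = {\<one>\<^bsub>G\<^esub>}"
| "trajectory G \<phi> F (Suc n) = trajectory G \<phi> F n <#>\<^bsub>G\<^esub> ((\<phi> ^^ n) ` F)"

definition H_ent :: "('a, 'b) monoid_scheme \<Rightarrow> ('a \<Rightarrow> 'a) \<Rightarrow> 'a set \<Rightarrow> real" where
  "H_ent G \<phi> F = lim (\<lambda>n. ln (real (card (trajectory G \<phi> F n))) / real n)"

definition ent :: "('a, 'b) monoid_scheme \<Rightarrow> ('a \<Rightarrow> 'a) \<Rightarrow> ereal" where
  "ent G \<phi> = (SUP F \<in> {F. subgroup F G \<and> finite F}. ereal (H_ent G \<phi> F))"

end

theory Submission
  imports Defs
begin

text \<open>
  All three conditions say the same thing: every element of \<open>G\<close> is quasi-periodic. Additive notation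
  is used in this overview.

  The common source is a rigidity property of a point \<open>z\<close> that is not quasi-periodic. Let \<open>F\<close> be the
  cyclic subgroup generated by \<open>z\<close>; it is finite because \<open>G\<close> is torsion. If \<open>\<phi>\<^sup>d(z)\<close> belonged to the
  trajectory \<open>T\<^sub>d(\<phi>, F)\<close>, this finite subgroup would be \<open>\<phi>\<close>-invariant and contain the whole orbit of
  \<open>z\<close>, so the orbit would repeat. Hence \<open>\<phi>\<^sup>d(z)\<close> is never an integer combination of the earlier
  iterates (\<open>top_iterate_notin_trajectory\<close>).

  Entropy. If all points are quasi-periodic, the iterates of \<open>\<phi>\<close> restricted to a finite subgroup
  repeat, so its trajectories stop growing and the entropy vanishes (\<open>ent_eq_0\<close>). If \<open>z\<close> is not
  quasi-periodic, the subgroups \<open>T\<^sub>n(\<phi>, F)\<close> increase strictly, so by Lagrange their orders at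
  least double at every step and the entropy is at least \<open>ln 2\<close> (\<open>ln_2_le_ent\<close>).

  Strings. The first entry of a non-singular string is not quasi-periodic, so without such points
  \<open>ns(\<phi>) = 0\<close>. Conversely, surjectivity extends a point \<open>z\<close> that is not quasi-periodic to a backward
  orbit \<open>x\<^sub>0 = z, x\<^sub>1, x\<^sub>2, \<dots>\<close>, and for every \<open>k > 0\<close> the sequence \<open>n \<mapsto> x\<^sub>n + \<phi>\<^sup>k(x\<^sub>n)\<close> is again a
  backward orbit. Think of \<open>z\<close> as \<open>1\<close> in a ring of Laurent polynomials in \<open>t\<close> on which \<open>\<phi>\<close> is
  multiplication by \<open>t\<close>: this sequence runs through \<open>t\<^sup>-\<^sup>n (1 + t\<^sup>k)\<close>, and the gap \<open>k\<close> between the two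
  exponents is the same for every entry and determines the sequence. Comparing highest terms makes
  this precise (\<open>binomial_relation_trivial\<close>). So these sequences form an infinite family of pairwise
  disjoint non-singular strings, and \<open>ns(\<phi>) = \<infinity>\<close>.
\<close>

section \<open>Subadditive sequences\<close>

text \<open>Fekete's lemma. It is needed because the entropy of a finite subgroup is defined by \<open>lim\<close>, which
  is an unspecified number when the sequence diverges.\<close>

lemma subadditive_imp_convergent:
  fixes u :: "nat \<Rightarrow> real"
  assumes nonneg: "\<And>n. 0 \<le> u n" and sub: "\<And>m n. u (m + n) \<le> u m + u n"
  shows "convergent (\<lambda>n. u n / real n)"
proof -
  define L where "L = Inf ((\<lambda>n. u n / real n) ` {1..})"
  have bdd: "bdd_below ((\<lambda>n. u n / real n) ` {1..})"
    by (rule bdd_belowI[of _ 0]) (auto simp: nonneg)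
  have L_le: "L \<le> u n / real n" if "n \<ge> 1" for n
    unfolding L_def using bdd that by (intro cInf_lower) auto
  have mult: "u (q * m + r) \<le> real q * u m + u r" for q m r
  proof (induction q)
    case (Suc q)
    have "u (Suc q * m + r) \<le> u m + u (q * m + r)"
      using sub[of m "q * m + r"] by (simp add: add.assoc)
    with Suc show ?case by (simp add: algebra_simps)
  qed simp
  have "(\<lambda>n. u n / real n) \<longlonglongrightarrow> L"
  proof (rule LIMSEQ_I)
    fix e :: real assume e: "0 < e"
    have "\<exists>y\<in>(\<lambda>n. u n / real n) ` {1..}. y < L + e / 2"
      by (rule cInf_lessD) (use e in \<open>auto simp: L_def\<close>)
    then obtain m where m: "m \<ge> 1" "u m / real m < L + e / 2" by auto
    \<comment> \<open>Dividing \<open>n\<close> by \<open>m\<close> leaves a remainder below \<open>m\<close>, whose contribution \<open>B\<close> bounds uniformly.\<close>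
    define B where "B = (\<Sum>r<m. u r)"
    have B: "u r \<le> B" if "r < m" for r
      unfolding B_def using that nonneg by (intro member_le_sum) auto
    have B0: "0 \<le> B" unfolding B_def by (intro sum_nonneg nonneg)
    obtain N where N: "2 * B / e < real N" using reals_Archimedean2 by blast
    have "norm (u n / real n - L) < e" if n: "n \<ge> N + 1" for n
    proof -
      have n0: "n > 0" using n by simp
      have "u n \<le> real (n div m) * u m + u (n mod m)"
        using mult[of "n div m" m "n mod m"] by simp
      also have "\<dots> \<le> real (n div m) * u m + B"
        using B[of "n mod m"] m by simp
      also have "real (n div m) * u m = real (n div m * m) * (u m / real m)"
        using m by simp
      also have "\<dots> \<le> real n * (u m / real m)"
        using nonneg[of m] by (intro mult_right_mono of_nat_mono div_times_less_eq_dividend) simp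
      finally have "u n / real n \<le> u m / real m + B / real n"
        using n0 by (simp add: field_simps)
      moreover have "B / real n < e / 2"
      proof -
        have "2 * B / e < real n" using N n by linarith
        then show ?thesis using e n0 by (simp add: field_simps)
      qed
      moreover have "L \<le> u n / real n" using L_le n by simp
      ultimately show ?thesis using m by (simp only: real_norm_def abs_less_iff) linarith
    qed
    then show "\<exists>no. \<forall>n\<ge>no. norm (u n / real n - L) < e" by blast
  qed
  then show ?thesis by (rule convergentI)
qed

section \<open>Iterates of an endomorphism\<close>

lemma (in group) subgroup_factor_mem:
  assumes "subgroup S G" "a \<in> S" "a \<otimes> b \<in> S" "b \<in> carrier G"
  shows "b \<in> S"
proof -
  have "a \<in> carrier G" using assms(1,2) by (rule subgroup.mem_carrier)
  then have "b = inv a \<otimes> (a \<otimes> b)" using assms(4) by (simp add: m_assoc [symmetric])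
  then show ?thesis
    using assms(1-3) subgroup.m_closed[OF assms(1)] subgroup.m_inv_closed[OF assms(1)] by metis
qed

locale abelian_endomorphism = comm_group G for G (structure) +
  fixes \<phi> :: "'a \<Rightarrow> 'a"
  assumes hom: "\<phi> \<in> hom G G"
begin

lemma hom_funpow: "\<phi> ^^ n \<in> hom G G"
proof (induction n)
  case 0
  then show ?case by (simp add: hom_def)
next
  case (Suc n)
  then show ?case using Group.hom_compose[OF Suc hom] by (simp add: comp_def)
qed

lemma funpow_closed [simp, intro]: "x \<in> carrier G \<Longrightarrow> (\<phi> ^^ n) x \<in> carrier G"
  using hom_funpow by (rule hom_in_carrier)

lemma funpow_mult:
  "\<lbrakk>x \<in> carrier G; y \<in> carrier G\<rbrakk> \<Longrightarrow> (\<phi> ^^ n) (x \<otimes> y) = (\<phi> ^^ n) x \<otimes> (\<phi> ^^ n) y"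
  using hom_funpow by (rule hom_mult)

lemma funpow_funpow: "(\<phi> ^^ m) ((\<phi> ^^ n) x) = (\<phi> ^^ (m + n)) x"
  by (simp add: funpow_add)

lemma group_hom_funpow: "group_hom G G (\<phi> ^^ n)"
  by (intro group_hom.intro group_hom_axioms.intro hom_funpow is_group)

lemma QPer_I:
  assumes "x \<in> carrier G" "(\<phi> ^^ m) x = (\<phi> ^^ n) x" "m \<noteq> n"
  shows "x \<in> QPer G \<phi>"
proof (cases "m < n")
  case True
  then show ?thesis using assms unfolding QPer_def by blast
next
  case False
  then have "n < m" using assms(3) by simp
  then show ?thesis using assms(1) assms(2)[symmetric] unfolding QPer_def by blast
qed

lemma QPer_iterate_iff:
  assumes "x \<in> carrier G"
  shows "(\<phi> ^^ k) x \<in> QPer G \<phi> \<longleftrightarrow> x \<in> QPer G \<phi>"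
proof
  assume "(\<phi> ^^ k) x \<in> QPer G \<phi>"
  then obtain n m where "n < m" "(\<phi> ^^ (n + k)) x = (\<phi> ^^ (m + k)) x"
    unfolding QPer_def by (auto simp: funpow_funpow)
  then show "x \<in> QPer G \<phi>" using assms by (intro QPer_I[of x "n + k" "m + k"]) auto
next
  assume "x \<in> QPer G \<phi>"
  then obtain n m where nm: "n < m" "(\<phi> ^^ n) x = (\<phi> ^^ m) x" unfolding QPer_def by blast
  have "(\<phi> ^^ n) ((\<phi> ^^ k) x) = (\<phi> ^^ k) ((\<phi> ^^ n) x)"
    by (simp add: funpow_funpow add.commute)
  also have "\<dots> = (\<phi> ^^ m) ((\<phi> ^^ k) x)"
    unfolding nm(2) by (simp add: funpow_funpow add.commute)
  finally show "(\<phi> ^^ k) x \<in> QPer G \<phi>" using nm(1) assms by (intro QPer_I[of _ n m]) auto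
qed

section \<open>Trajectories\<close>

abbreviation T :: "'a set \<Rightarrow> nat \<Rightarrow> 'a set" where "T \<equiv> trajectory G \<phi>"

lemma subgroup_funpow_image: "subgroup F G \<Longrightarrow> subgroup ((\<phi> ^^ n) ` F) G"
  using group_hom.subgroup_img_is_subgroup[OF group_hom_funpow] .

lemma subgroup_trajectory: "subgroup F G \<Longrightarrow> subgroup (T F n) G"
  by (induction n) (auto intro: mult_subgroups subgroup_funpow_image triv_subgroup)

lemma finite_trajectory: "finite F \<Longrightarrow> finite (T F n)"
  by (induction n) (auto simp: set_mult_def)

lemma iterate_subset_trajectory:
  assumes F: "subgroup F G" and "i < n"
  shows "(\<phi> ^^ i) ` F \<subseteq> T F n"
  using assms(2)
proof (induction n)
  case (Suc n)
  note sub = subgroup_trajectory[OF F, of n] subgroup_funpow_image[OF F, of n]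
  have carr: "T F n \<subseteq> carrier G" "(\<phi> ^^ n) ` F \<subseteq> carrier G"
    using sub by (auto dest: subgroup.subset)
  have "T F n \<subseteq> T F (Suc n)"
  proof
    fix t assume "t \<in> T F n"
    moreover have "t = t \<otimes> \<one>" using \<open>t \<in> T F n\<close> carr by auto
    ultimately show "t \<in> T F (Suc n)"
      using subgroup.one_closed[OF sub(2)] unfolding trajectory.simps set_mult_def by blast
  qed
  moreover have "(\<phi> ^^ n) ` F \<subseteq> T F (Suc n)"
  proof
    fix t assume "t \<in> (\<phi> ^^ n) ` F"
    moreover have "t = \<one> \<otimes> t" using \<open>t \<in> (\<phi> ^^ n) ` F\<close> carr by auto
    ultimately show "t \<in> T F (Suc n)"
      using subgroup.one_closed[OF sub(1)] unfolding trajectory.simps set_mult_def by blast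
  qed
  ultimately show ?case using Suc by (cases "i = n") auto
qed simp

lemma trajectory_least:
  assumes "subgroup S G" "\<And>i. i < n \<Longrightarrow> (\<phi> ^^ i) ` F \<subseteq> S"
  shows "T F n \<subseteq> S"
  using assms(2)
proof (induction n)
  case 0
  then show ?case using subgroup.one_closed[OF assms(1)] by simp
next
  case (Suc n)
  then have "T F n \<subseteq> S" "(\<phi> ^^ n) ` F \<subseteq> S" by auto
  then show ?case using subgroup.m_closed[OF assms(1)] by (auto simp: set_mult_def)
qed

lemma trajectory_mono:
  assumes "subgroup F G" "m \<le> n"
  shows "T F m \<subseteq> T F n"
  using assms by (intro trajectory_least subgroup_trajectory iterate_subset_trajectory) auto

lemma image_trajectory_subset:
  assumes F: "subgroup F G"
  shows "\<phi> ` T F n \<subseteq> T F (Suc n)"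
proof (induction n)
  case 0
  have "\<phi> \<one> = \<one>" using hom_one[OF hom] is_group by blast
  then show ?case using subgroup.one_closed[OF subgroup_trajectory[OF F]] by (metis image_subset_iff singletonD trajectory.simps(1))
next
  case (Suc n)
  have "\<phi> ` T F (Suc n) = \<phi> ` T F n <#> \<phi> ` (\<phi> ^^ n) ` F"
    unfolding trajectory.simps
    using subgroup.subset[OF subgroup_trajectory[OF F]] subgroup.subset[OF subgroup_funpow_image[OF F]]
    by (intro set_mult_hom[OF hom]) auto
  also have "\<phi> ` (\<phi> ^^ n) ` F = (\<phi> ^^ Suc n) ` F" by (simp add: image_comp)
  also have "\<phi> ` T F n <#> (\<phi> ^^ Suc n) ` F \<subseteq> T F (Suc n) <#> (\<phi> ^^ Suc n) ` F"
    by (intro mono_set_mult Suc order_refl)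
  finally show ?case by simp
qed

text \<open>Once the trajectory absorbs one iterate of \<open>F\<close>, it is invariant under \<open>\<phi>\<close>, because \<open>\<phi>\<close> moves
  each trajectory into the next one.\<close>

lemma trajectory_stable:
  assumes F: "subgroup F G" and d: "(\<phi> ^^ d) ` F \<subseteq> T F d"
  shows "(\<phi> ^^ n) ` F \<subseteq> T F d"
proof (induction n)
  case 0
  show ?case
  proof (cases d)
    case 0
    then show ?thesis using d by simp
  next
    case (Suc k)
    then show ?thesis using iterate_subset_trajectory[OF F, of 0 d] by simp
  qed
next
  case (Suc n)
  have "T F (Suc d) \<subseteq> T F d"
  proof (intro trajectory_least subgroup_trajectory F)
    show "(\<phi> ^^ i) ` F \<subseteq> T F d" if "i < Suc d" for i
      using d iterate_subset_trajectory[OF F, of i d] that by (cases "i = d") auto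
  qed
  then have "\<phi> ` T F d \<subseteq> T F d" using image_trajectory_subset[OF F, of d] by blast
  moreover have "(\<phi> ^^ Suc n) ` F = \<phi> ` (\<phi> ^^ n) ` F" by (simp add: image_comp)
  ultimately show ?case using Suc by blast
qed

lemma trajectory_add:
  assumes F: "subgroup F G"
  shows "T F (m + n) = T F m <#> (\<phi> ^^ m) ` T F n"
proof -
  note sub = subgroup_trajectory[OF F]
  have carr: "T F k \<subseteq> carrier G" "(\<phi> ^^ j) ` T F k \<subseteq> carrier G" "(\<phi> ^^ k) ` F \<subseteq> carrier G" for j k
    using sub[of k] subgroup_funpow_image[OF sub[of k]] subgroup_funpow_image[OF F]
    by (meson subgroup.subset)+
  show ?thesis
  proof (induction n)
    case 0
    have "(\<phi> ^^ m) \<one> = \<one>" using hom_one[OF hom_funpow] is_group by blast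
    then show ?case using carr(1)[of m] by (force simp: set_mult_def)
  next
    case (Suc n)
    have "T F (m + Suc n) = (T F m <#> (\<phi> ^^ m) ` T F n) <#> (\<phi> ^^ (m + n)) ` F"
      using Suc by simp
    also have "\<dots> = T F m <#> ((\<phi> ^^ m) ` T F n <#> (\<phi> ^^ (m + n)) ` F)"
      using carr by (intro set_mult_assoc)
    also have "(\<phi> ^^ (m + n)) ` F = (\<phi> ^^ m) ` (\<phi> ^^ n) ` F"
      by (simp add: image_comp funpow_add)
    also have "(\<phi> ^^ m) ` T F n <#> (\<phi> ^^ m) ` (\<phi> ^^ n) ` F = (\<phi> ^^ m) ` T F (Suc n)"
      unfolding trajectory.simps
      using carr by (intro set_mult_hom[OF hom_funpow, symmetric])
    finally show ?case .
  qed
qed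

lemma card_trajectory_pos:
  assumes "subgroup F G" "finite F"
  shows "0 < card (T F n)"
  using assms finite_trajectory subgroup.one_closed[OF subgroup_trajectory] by (metis card_gt_0_iff empty_iff)

lemma card_trajectory_add:
  assumes F: "subgroup F G" "finite F"
  shows "card (T F (m + n)) \<le> card (T F m) * card (T F n)"
proof -
  have "T F m <#> (\<phi> ^^ m) ` T F n = (\<lambda>(a, b). a \<otimes> (\<phi> ^^ m) b) ` (T F m \<times> T F n)"
    by (auto simp: set_mult_def)
  then show ?thesis
    unfolding trajectory_add[OF F(1)] card_cartesian_product[symmetric]
    using finite_trajectory[OF F(2)] by (metis card_image_le finite_cartesian_product)
qed

text \<open>The cardinality of \<open>T F n\<close> is submultiplicative in \<open>n\<close>, so its logarithm is subadditive.\<close>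

lemma H_ent_LIMSEQ:
  assumes F: "subgroup F G" "finite F"
  shows "(\<lambda>n. ln (real (card (T F n))) / real n) \<longlonglongrightarrow> H_ent G \<phi> F"
proof -
  note pos = card_trajectory_pos[OF F]
  have "convergent (\<lambda>n. ln (real (card (T F n))) / real n)"
  proof (rule subadditive_imp_convergent)
    show "0 \<le> ln (real (card (T F n)))" for n using pos[of n] by simp
    fix m n
    have "ln (real (card (T F (m + n)))) \<le> ln (real (card (T F m) * card (T F n)))"
      using card_trajectory_add[OF F, of m n] pos
      by (subst ln_le_cancel_iff) (simp_all del: of_nat_mult)
    also have "\<dots> = ln (real (card (T F m))) + ln (real (card (T F n)))"
      using pos[of m] pos[of n] by (simp add: ln_mult)
    finally show "ln (real (card (T F (m + n)))) \<le> ln (real (card (T F m))) + ln (real (card (T F n)))" .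
  qed
  then show ?thesis unfolding H_ent_def convergent_LIMSEQ_iff .
qed

section \<open>Entropy and quasi-periodic points\<close>

text \<open>The orbits of the finitely many points of \<open>F\<close> are finite, so only finitely many maps arise by
  restricting iterates of \<open>\<phi>\<close> to \<open>F\<close>. Two of these restrictions coincide, and then the trajectory of
  \<open>F\<close> stabilises and the entropy is a limit of \<open>ln c / n\<close> with \<open>c\<close> constant.\<close>

lemma H_ent_eq_0:
  assumes F: "subgroup F G" "finite F" and Q: "F \<subseteq> QPer G \<phi>"
  shows "H_ent G \<phi> F = 0"
proof -
  \<comment> \<open>A finite set that receives the values of all iterates on \<open>F\<close>.\<close>
  define A where "A = (\<Union>x\<in>F. range (\<lambda>n. (\<phi> ^^ n) x))"
  have orbit: "finite (range (\<lambda>n. (\<phi> ^^ n) x))" if x: "x \<in> F" for x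
  proof -
    obtain n m where nm: "n < m" "(\<phi> ^^ n) x = (\<phi> ^^ m) x"
      using x Q unfolding QPer_def by blast
    have "(\<phi> ^^ k) x \<in> (\<lambda>n. (\<phi> ^^ n) x) ` {..<m}" for k
    proof (induction k rule: less_induct)
      case (less k)
      show ?case
      proof (cases "k < m")
        case False
        have "(\<phi> ^^ k) x = (\<phi> ^^ (k - m)) ((\<phi> ^^ m) x)"
          using False by (simp add: funpow_funpow)
        also have "\<dots> = (\<phi> ^^ (k - m + n)) x"
          using nm(2) by (simp add: funpow_funpow [symmetric])
        finally show ?thesis using less[of "k - m + n"] nm(1) False by simp
      qed auto
    qed
    then show ?thesis by (meson finite_imageI finite_lessThan finite_subset image_subsetI)
  qed
  have "finite A" unfolding A_def using orbit F(2) by blast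
  then have "finite (F \<rightarrow>\<^sub>E A)" using F(2) by (intro finite_PiE)
  moreover have "range (\<lambda>n. restrict (\<phi> ^^ n) F) \<subseteq> F \<rightarrow>\<^sub>E A"
    unfolding A_def by auto
  ultimately have "\<not> inj (\<lambda>n. restrict (\<phi> ^^ n) F)"
    using finite_subset infinite_UNIV_nat by (metis finite_imageD)
  then obtain n m where nm: "n < m" "restrict (\<phi> ^^ n) F = restrict (\<phi> ^^ m) F"
    unfolding inj_def by (metis nat_neq_iff)
  have "(\<phi> ^^ m) ` F = (\<phi> ^^ n) ` F" using nm(2) by (metis image_restrict_eq)
  then have "(\<phi> ^^ m) ` F \<subseteq> T F m"
    using iterate_subset_trajectory[OF F(1) nm(1)] by simp
  then have stable: "(\<phi> ^^ i) ` F \<subseteq> T F m" for i by (rule trajectory_stable[OF F(1)])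
  have "card (T F n) \<le> card (T F m)" for n
    using stable by (intro card_mono finite_trajectory F trajectory_least subgroup_trajectory)
  then have bound: "ln (real (card (T F n))) / real n \<le> ln (real (card (T F m))) / real n" for n
    using card_trajectory_pos[OF F] by (intro divide_right_mono) simp_all
  have "(\<lambda>n. ln (real (card (T F n))) / real n) \<longlonglongrightarrow> 0"
  proof (rule tendsto_sandwich
      [of "\<lambda>_. 0" _ sequentially "\<lambda>n. ln (real (card (T F m))) / real n"])
    show "(\<lambda>n. ln (real (card (T F m))) / real n) \<longlonglongrightarrow> 0"
      by (rule lim_const_over_n)
    show "(\<lambda>n. 0) \<longlonglongrightarrow> (0 :: real)" by simp
    have "0 \<le> ln (real (card (T F n)))" for n using card_trajectory_pos[OF F, of n] by simp
    then show "\<forall>\<^sub>F n in sequentially. 0 \<le> ln (real (card (T F n))) / real n" by simp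
    show "\<forall>\<^sub>F n in sequentially. ln (real (card (T F n))) / real n \<le> ln (real (card (T F m))) / real n"
      using bound by simp
  qed
  with H_ent_LIMSEQ[OF F] show ?thesis by (rule LIMSEQ_unique)
qed

lemma finite_generate_singleton:
  assumes "torsion_group G" "x \<in> carrier G"
  shows "finite (generate G {x})"
  using assms finite_cyclic_subgroup[of x] unfolding torsion_group_def carrier_subgroup_generated
  by (auto simp: Int_absorb1)

text \<open>A monic relation expressing \<open>\<phi>\<^sup>d(z)\<close> through lower iterates would confine the orbit of \<open>z\<close> to the
  finite group \<open>T (generate G {z}) d\<close>. Since the leading coefficient is \<open>1\<close>, the
  argument applies to a \<open>z\<close> of any finite order.\<close>

lemma top_iterate_notin_trajectory:
  assumes tors: "torsion_group G" and z: "z \<in> carrier G" "z \<notin> QPer G \<phi>"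
  shows "(\<phi> ^^ d) z \<notin> T (generate G {z}) d"
proof
  let ?F = "generate G {z}"
  assume *: "(\<phi> ^^ d) z \<in> T ?F d"
  have F: "subgroup ?F G" using z by (intro generate_is_subgroup) simp
  have "(\<phi> ^^ d) ` ?F = generate G ((\<phi> ^^ d) ` {z})"
    using z by (intro group_hom.generate_img[OF group_hom_funpow, symmetric]) simp
  also have "\<dots> \<subseteq> T ?F d"
    using * by (intro generate_subgroup_incl subgroup_trajectory F) simp
  finally have "(\<phi> ^^ n) ` ?F \<subseteq> T ?F d" for n by (rule trajectory_stable[OF F])
  then have "range (\<lambda>n. (\<phi> ^^ n) z) \<subseteq> T ?F d" using generate.incl[of z "{z}" G] by blast
  then have "finite (range (\<lambda>n. (\<phi> ^^ n) z))"
    using finite_trajectory[OF finite_generate_singleton[OF tors z(1)]] finite_subset by blast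
  then have "\<not> inj (\<lambda>n. (\<phi> ^^ n) z)" using finite_imageD infinite_UNIV_nat by blast
  then show False using z QPer_I unfolding inj_def by blast
qed

text \<open>Each trajectory is a proper subgroup of the next one, hence of index at least two.\<close>

lemma exp_le_card_trajectory:
  assumes tors: "torsion_group G" and z: "z \<in> carrier G" "z \<notin> QPer G \<phi>"
  shows "2 ^ n \<le> card (T (generate G {z}) n)"
proof (induction n)
  case (Suc n)
  let ?F = "generate G {z}"
  have F: "subgroup ?F G" using z by (intro generate_is_subgroup) simp
  have fin: "finite (T ?F k)" for k
    by (rule finite_trajectory[OF finite_generate_singleton[OF tors z(1)]])
  let ?G' = "G\<lparr>carrier := T ?F (Suc n)\<rparr>"
  have sub: "T ?F n \<subseteq> T ?F (Suc n)" by (rule trajectory_mono[OF F]) simp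
  have "subgroup (T ?F n) ?G'" by (intro subgroup_incl subgroup_trajectory F sub)
  from group.lagrange[OF subgroup_imp_group[OF subgroup_trajectory[OF F]] this]
  have "card (T ?F n) dvd order ?G'" by (rule dvdI[OF trans[OF sym mult.commute]])
  then have "card (T ?F n) dvd card (T ?F (Suc n))" by (simp add: order_def)
  then obtain c where c: "card (T ?F (Suc n)) = card (T ?F n) * c" by blast
  have "(\<phi> ^^ n) z \<in> T ?F (Suc n)"
    using iterate_subset_trajectory[OF F, of n "Suc n"] generate.incl[of z "{z}" G] by blast
  then have "T ?F n \<subset> T ?F (Suc n)"
    using sub top_iterate_notin_trajectory[OF tors z, of n] by blast
  then have "card (T ?F n) < card (T ?F (Suc n))" by (rule psubset_card_mono[OF fin])
  then have "c \<noteq> 0" "c \<noteq> 1" using c by auto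
  then have "2 \<le> c" by linarith
  then have "card (T ?F n) * 2 \<le> card (T ?F (Suc n))" unfolding c by (rule mult_le_mono2)
  with Suc show ?case by simp
qed simp

lemma ent_eq_0:
  assumes "carrier G \<subseteq> QPer G \<phi>"
  shows "ent G \<phi> = 0"
proof -
  have "H_ent G \<phi> F = 0" if "subgroup F G" "finite F" for F
    using that assms subgroup.subset by (intro H_ent_eq_0) blast+
  then have "ent G \<phi> = (SUP F \<in> {F. subgroup F G \<and> finite F}. (0 :: ereal))"
    unfolding ent_def by (intro SUP_cong) (auto simp: zero_ereal_def)
  also have "{\<one>} \<in> {F. subgroup F G \<and> finite F}" using triv_subgroup by simp
  then have "(SUP F \<in> {F. subgroup F G \<and> finite F}. (0 :: ereal)) = 0"
    by (intro cSUP_const) blast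
  finally show ?thesis .
qed

lemma ln_2_le_ent:
  assumes tors: "torsion_group G" and z: "z \<in> carrier G" "z \<notin> QPer G \<phi>"
  shows "ereal (ln 2) \<le> ent G \<phi>"
proof -
  let ?F = "generate G {z}"
  have F: "subgroup ?F G" "finite ?F"
    using z finite_generate_singleton[OF tors] by (auto intro: generate_is_subgroup)
  have "ln 2 \<le> ln (real (card (T ?F n))) / real n" if "n \<ge> 1" for n
  proof -
    have "real n * ln 2 = ln (2 ^ n)" by (simp add: ln_realpow)
    also have "\<dots> \<le> ln (real (card (T ?F n)))"
      using exp_le_card_trajectory[OF tors z, of n] card_trajectory_pos[OF F, of n]
      by (subst ln_le_cancel_iff) (simp_all add: numeral_power_le_of_nat_cancel_iff)
    finally show ?thesis using that by (simp add: field_simps)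
  qed
  then have "ln 2 \<le> H_ent G \<phi> ?F" using H_ent_LIMSEQ[OF F] by (meson LIMSEQ_le_const)
  then have "ereal (ln 2) \<le> ereal (H_ent G \<phi> ?F)" by simp
  also have "\<dots> \<le> ent G \<phi>" unfolding ent_def using F by (intro SUP_upper) simp
  finally show ?thesis .
qed

section \<open>Strings\<close>

lemma backward_orbit_funpow:
  assumes "\<And>n. \<phi> (x (Suc n)) = x n"
  shows "(\<phi> ^^ k) (x (n + k)) = x n"
proof (induction k)
  case (Suc k)
  have "(\<phi> ^^ Suc k) (x (n + Suc k)) = (\<phi> ^^ k) (\<phi> (x (Suc (n + k))))"
    by (simp only: funpow_Suc_right o_apply add_Suc_right)
  also have "\<dots> = x n" unfolding assms by (rule Suc)
  finally show ?case .
qed simp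

text \<open>A repetition in a backward orbit makes one of its entries periodic, and then \<open>x 0\<close>, an iterate of
  that entry, is quasi-periodic.\<close>

lemma backward_orbit_is_string:
  assumes carr: "\<And>n. x n \<in> carrier G" and pre: "\<And>n. \<phi> (x (Suc n)) = x n"
    and x0: "x 0 \<notin> QPer G \<phi>"
  shows "is_string G \<phi> x"
proof -
  have "x m \<noteq> x n" if "m < n" for m n
  proof
    assume eq: "x m = x n"
    have "(\<phi> ^^ (n - m)) (x n) = x m"
      using backward_orbit_funpow[of x "n - m" m] pre that by simp
    then have "x n \<in> QPer G \<phi>"
      using eq that carr by (intro QPer_I[of _ "n - m" 0]) auto
    moreover have "(\<phi> ^^ n) (x n) = x 0" using backward_orbit_funpow[of x n 0] pre by simp
    ultimately show False using x0 carr QPer_iterate_iff by metis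
  qed
  then have "inj x" by (metis injI nat_neq_iff)
  moreover have "\<phi> (x n) = x (n - 1)" if "n \<ge> 1" for n using pre[of "n - 1"] that by simp
  ultimately show ?thesis unfolding is_string_def using carr by blast
qed

text \<open>In terms of exponents, \<open>t\<^sup>d (1 + t\<^sup>k) = 1 + t\<^sup>l\<close> is possible only in the trivial way. If the highest exponents
  \<open>d + k\<close> and \<open>l\<close> differ, the larger one occurs just once and its iterate would lie in the span of
  lower ones; if they agree, that term cancels and \<open>z\<close> is fixed by \<open>\<phi>\<^sup>d\<close>, so \<open>d = 0\<close>.\<close>

lemma binomial_relation_trivial:
  assumes tors: "torsion_group G" and z: "z \<in> carrier G" "z \<notin> QPer G \<phi>"
    and k: "0 < k" and l: "0 < l"
    and eq: "(\<phi> ^^ d) z \<otimes> (\<phi> ^^ (d + k)) z = z \<otimes> (\<phi> ^^ l) z"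
  shows "d = 0 \<and> k = l"
proof -
  let ?F = "generate G {z}"
  have F: "subgroup ?F G" using z by (intro generate_is_subgroup) simp
  have mem: "(\<phi> ^^ i) z \<in> T ?F n" if "i < n" for i n
    using iterate_subset_trajectory[OF F that] generate.incl[of z "{z}" G] by blast
  have mem0: "z \<in> T ?F n" if "0 < n" for n using mem[OF that] by simp
  have mult: "a \<otimes> b \<in> T ?F n" if "a \<in> T ?F n" "b \<in> T ?F n" for a b n
    using subgroup.m_closed[OF subgroup_trajectory[OF F]] that by blast
  note top = top_iterate_notin_trajectory[OF tors z]
  consider "l < d + k" | "d + k < l" | "d + k = l" by linarith
  then show ?thesis
  proof cases
    case 1
    have "(\<phi> ^^ (d + k)) z \<in> T ?F (d + k)"
    proof (rule subgroup_factor_mem[OF subgroup_trajectory[OF F]])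
      show "(\<phi> ^^ d) z \<in> T ?F (d + k)" using k by (intro mem) simp
      show "(\<phi> ^^ d) z \<otimes> (\<phi> ^^ (d + k)) z \<in> T ?F (d + k)"
        unfolding eq using 1 k by (intro mult mem mem0) auto
    qed (use z in auto)
    then show ?thesis using top by blast
  next
    case 2
    have "(\<phi> ^^ l) z \<in> T ?F l"
    proof (rule subgroup_factor_mem[OF subgroup_trajectory[OF F]])
      show "z \<in> T ?F l" by (rule mem0[OF l])
      show "z \<otimes> (\<phi> ^^ l) z \<in> T ?F l"
        unfolding eq[symmetric] using 2 by (intro mult mem) auto
    qed (use z in auto)
    then show ?thesis using top by blast
  next
    case 3
    then have "(\<phi> ^^ d) z = (\<phi> ^^ 0) z" using eq z by (simp add: r_cancel)
    then have "d = 0" using QPer_I z by blast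
    with 3 show ?thesis by simp
  qed
qed

text \<open>The strings are \<open>n \<mapsto> x n \<otimes> (\<phi> ^^ k) (x n)\<close> for \<open>k > 0\<close>, where \<open>x\<close> is a backward orbit of \<open>z\<close>. Two of them
  that meet, and likewise one whose first entry is quasi-periodic, would give a nontrivial relation of
  the kind excluded by \<open>binomial_relation_trivial\<close>.\<close>

lemma infinite_nonsingular_string_family:
  assumes tors: "torsion_group G" and surj: "\<phi> ` carrier G = carrier G"
    and z: "z \<in> carrier G" "z \<notin> QPer G \<phi>"
  obtains \<F> where "nonsingular_string_family G \<phi> \<F>" "infinite \<F>"
proof -
  have "\<exists>x. \<forall>n. (x n \<in> carrier G \<and> (n = 0 \<longrightarrow> x n = z)) \<and> \<phi> (x (Suc n)) = x n"
  proof (rule dependent_nat_choice)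
    fix w and n :: nat
    assume "w \<in> carrier G \<and> (n = 0 \<longrightarrow> w = z)"
    then show "\<exists>y. (y \<in> carrier G \<and> (Suc n = 0 \<longrightarrow> y = z)) \<and> \<phi> y = w"
      using surj by (metis imageE nat.distinct(1))
  qed (use z in blast)
  then obtain x where x: "\<And>n. x n \<in> carrier G" "\<And>n. \<phi> (x (Suc n)) = x n" "x 0 = z" by auto
  have nonper: "x n \<notin> QPer G \<phi>" for n
    using backward_orbit_funpow[of x n 0] x z QPer_iterate_iff[of "x n" n] by simp
  define y where "y k n = x n \<otimes> (\<phi> ^^ k) (x n)" for k n
  have eq_index: "k = l" if eq: "y k n = y l m" and kl: "0 < k" "0 < l" and "n \<le> m" for k l m n
  proof -
    \<comment> \<open>Both entries are written through the later point \<open>x m\<close>, so that only iterates of \<open>\<phi>\<close> occur.\<close>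
    have "x n = (\<phi> ^^ (m - n)) (x m)"
      using backward_orbit_funpow[of x "m - n" n] x \<open>n \<le> m\<close> by simp
    then have "(\<phi> ^^ (m - n)) (x m) \<otimes> (\<phi> ^^ (m - n + k)) (x m) = x m \<otimes> (\<phi> ^^ l) (x m)"
      using eq unfolding y_def by (simp add: funpow_funpow add.commute)
    from binomial_relation_trivial[OF tors x(1) nonper kl this] show ?thesis by simp
  qed
  then have eq_index': "k = l" if "y k n = y l m" "0 < k" "0 < l" for k l m n
    using that by (metis nat_le_linear)
  have nonsing: "y k 0 \<notin> QPer G \<phi>" if k: "0 < k" for k
  proof
    assume "y k 0 \<in> QPer G \<phi>"
    then obtain n m where nm: "n < m" "(\<phi> ^^ n) (y k 0) = (\<phi> ^^ m) (y k 0)"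
      unfolding QPer_def by blast
    \<comment> \<open>Shifting by \<open>n\<close> turns the coincidence into the relation with \<open>k = l\<close> and \<open>d = m - n > 0\<close>.\<close>
    define w where "w = (\<phi> ^^ n) z"
    have w: "w \<in> carrier G" "w \<notin> QPer G \<phi>"
      unfolding w_def using z QPer_iterate_iff by auto
    have iter: "(\<phi> ^^ i) (y k 0) = (\<phi> ^^ i) z \<otimes> (\<phi> ^^ (i + k)) z" for i
      using z x by (simp add: y_def funpow_mult funpow_funpow)
    have "(\<phi> ^^ (m - n)) w \<otimes> (\<phi> ^^ (m - n + k)) w = w \<otimes> (\<phi> ^^ k) w"
      using nm unfolding iter w_def by (simp add: funpow_funpow add.commute)
    from binomial_relation_trivial[OF tors w k k this] nm(1) show False by simp
  qed
  have string: "is_string G \<phi> (y k)" if "0 < k" for k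
  proof (rule backward_orbit_is_string)
    show "y k n \<in> carrier G" for n using x by (simp add: y_def)
    show "\<phi> (y k (Suc n)) = y k n" for n
    proof -
      have "\<phi> (y k (Suc n)) = \<phi> (x (Suc n)) \<otimes> (\<phi> ^^ k) (\<phi> (x (Suc n)))"
        using x hom_mult[OF hom] by (simp add: y_def funpow_swap1)
      then show ?thesis using x by (simp add: y_def)
    qed
    show "y k 0 \<notin> QPer G \<phi>" by (rule nonsing[OF that])
  qed
  have "nonsingular_string_family G \<phi> (y ` {0<..})"
    unfolding nonsingular_string_family_def singular_def disjoint_family_on_def
  proof (intro conjI ballI impI)
    fix a b assume "a \<in> y ` {0<..}" "b \<in> y ` {0<..}" "a \<noteq> b"
    then obtain k l where kl: "0 < k" "0 < l" "a = y k" "b = y l" "k \<noteq> l" by auto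
    show "range a \<inter> range b = {}" using kl eq_index' by blast
  qed (auto simp: string nonsing)
  moreover have "inj_on y {0<..}" using eq_index' by (metis greaterThan_iff inj_onI)
  then have "infinite (y ` {0<..})" by (simp add: finite_image_iff infinite_Ioi)
  ultimately show ?thesis by (rule that)
qed

end

theorem mainTheorem8:
  fixes G :: "('a, 'b) monoid_scheme" and \<phi> :: "'a \<Rightarrow> 'a"
  assumes "comm_group G" and "torsion_group G"
    and "\<phi> \<in> hom G G" and "\<phi> ` carrier G = carrier G"
  shows "(ns G \<phi> = 0 \<longleftrightarrow> ns G \<phi> < \<infinity>) \<and> (ns G \<phi> < \<infinity> \<longleftrightarrow> ent G \<phi> = 0)"
proof -
  interpret abelian_endomorphism G \<phi>
    using assms(1,3) by (intro abelian_endomorphism.intro abelian_endomorphism_axioms.intro)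
  show ?thesis
  proof (cases "carrier G \<subseteq> QPer G \<phi>")
    case True
    have "\<F> = {}" if "nonsingular_string_family G \<phi> \<F>" for \<F>
      using that True
      unfolding nonsingular_string_family_def is_string_def singular_def by blast
    then have "ecardinality \<F> = 0" if "nonsingular_string_family G \<phi> \<F>" for \<F>
      using that by (force simp: ecardinality_def zero_enat_def)
    then have "ns G \<phi> \<le> 0" unfolding ns_def by (intro SUP_least) simp
    then show ?thesis using ent_eq_0[OF True] by simp
  next
    case False
    then obtain z where z: "z \<in> carrier G" "z \<notin> QPer G \<phi>" by blast
    obtain \<F> where \<F>: "nonsingular_string_family G \<phi> \<F>" "infinite \<F>"
      using infinite_nonsingular_string_family[OF assms(2,4) z] .
    have "ecardinality \<F> \<le> ns G \<phi>" unfolding ns_def using \<F>(1) by (intro SUP_upper) simp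
    then have "ns G \<phi> = \<infinity>" using \<F>(2) by (simp add: ecardinality_def)
    moreover have "(0 :: ereal) < ereal (ln 2)" by simp
    then have "ent G \<phi> \<noteq> 0" using ln_2_le_ent[OF assms(2) z] by (metis leD)
    ultimately show ?thesis by simp
  qed
qed

end
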